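(* Let $n\ge2$. For every $r\in[0,1]$ there exist unitaries $u,v\in\mathbb{M}_n(\mathbb{C})$ such that $$\cos\alpha\left(u\Delta^{(n)}u^*,v\Delta^{(n)}v^*\right)=r.$$
   Context: $\Delta^{(n)}$ denotes the algebra of diagonal matrices in $\mathbb{M}_n(\mathbb{C})$. Interior angle (taken with respect to $E_0(X)=\frac1n\operatorname{Tr}(X)\mathbb{I}_n$): view $\mathbb{M}_n(\mathbb{C})$ as a Hilbert space with inner product $\langle X,Y\rangle_\tau=\frac1n\operatorname{Tr}(X^*Y)$, and let $\mathbb{M}_n(\mathbb{C})$ act on it by left multiplication. For a unital $C^*$-subalgebra $\mathcal{C}\subseteq\mathbb{M}_n(\mathbb{C})$ let $e_{\mathcal{C}}\in\mathcal{B}(\mathbb{M}_n(\mathbb{C}))$ be the Jones projection $X\mapsto E_{\mathcal{C}}(X)$, where $E_{\mathcal{C}}$ is the trace-preserving conditional expectation onto $\mathcal{C}$ (equivalently, $e_{\mathcal{C}}$ is the orthogonal projection onto $\mathcal{C}$), and let $e_1:=e_{\mathbb{C}\mathbb{I}_n}$. Let $\tilde{E}:\mathcal{B}(\mathbb{M}_n(\mathbb{C}))\to\mathbb{M}_n(\mathbb{C})$ be the dual conditional expectation, i.e. the linear map determined by $\tilde{E}(xe_1y)=\frac1{n^2}xy$ for $x,y\in\mathbb{M}_n(\mathbb{C})$. (Identifying $A\otimes B$ with the operator $X\mapsto AXB^T$, one has $\tilde{E}(A\otimes B)=\frac1n\operatorname{Tr}(B)A$.) For $S,T\in\mathcal{B}(\mathbb{M}_n(\mathbb{C}))$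 put $\langle S,T\rangle:=\tilde{E}(S^*T)$ and $\|S\|_{\sim}:=\|\tilde{E}(S^*S)\|^{1/2}$, with the operator norm on $\mathbb{M}_n(\mathbb{C})$. For unital $C^*$-subalgebras $\mathcal{C},\mathcal{D}\neq\mathbb{C}\mathbb{I}_n$, $\alpha(\mathcal{C},\mathcal{D})$ is the unique element of $[0,\pi/2]$ with $$\cos\alpha(\mathcal{C},\mathcal{D})=\frac{\|\langle e_{\mathcal{C}}-e_1,\,e_{\mathcal{D}}-e_1\rangle\|}{\|e_{\mathcal{C}}-e_1\|_{\sim}\,\|e_{\mathcal{D}}-e_1\|_{\sim}}.$$ *)

theory Defs
  imports "HOL-Analysis.Analysis"
begin

text \<open>
  The algebra of complex \<open>n \<times> n\<close> matrices is the type \<open>complex^'n^'n\<close> with \<open>n = CARD('n)\<close>;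
  \<open>B(M\<^sub>n)\<close> is the set \<open>superops\<close> of complex-linear self-maps of that type.
\<close>

subsection \<open>Matrices\<close>

text \<open>The library has no complex scalar multiplication on \<open>complex^'n^'n\<close>.\<close>

definition cscale :: "complex \<Rightarrow> complex^'n^'m \<Rightarrow> complex^'n^'m" where
  "cscale c A = (\<chi> i j. c * A $ i $ j)"

definition madj :: "complex^'n^'m \<Rightarrow> complex^'m^'n" where
  "madj A = (\<chi> i j. cnj (A $ j $ i))"

definition unitary_matrix :: "complex^'n^'n \<Rightarrow> bool" where
  "unitary_matrix u \<longleftrightarrow> madj u ** u = mat 1 \<and> u ** madj u = mat 1"

definition matrix_opnorm :: "complex^'n^'n \<Rightarrow> real" where
  "matrix_opnorm A = onorm ((*v) A)"

definition tau_inner :: "complex^'n^'n \<Rightarrow> complex^'n^'n \<Rightarrow> complex" where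
  "tau_inner X Y = trace (madj X ** Y) / of_nat CARD('n)"

subsection \<open>Subalgebras\<close>

text \<open>Norm closedness is automatic in finite dimension.\<close>

definition unital_cstar_subalgebra :: "(complex^'n^'n) set \<Rightarrow> bool" where
  "unital_cstar_subalgebra C \<longleftrightarrow>
     mat 1 \<in> C \<and>
     (\<forall>x\<in>C. \<forall>y\<in>C. x + y \<in> C \<and> x ** y \<in> C) \<and>
     (\<forall>c. \<forall>x\<in>C. cscale c x \<in> C) \<and>
     (\<forall>x\<in>C. madj x \<in> C)"

definition scalar_algebra :: "(complex^'n^'n) set" where
  "scalar_algebra = range mat"

definition diagonal_algebra :: "(complex^'n^'n) set" where
  "diagonal_algebra = {A. \<forall>i j. i \<noteq> j \<longrightarrow> A $ i $ j = 0}"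

definition conj_algebra :: "complex^'n^'n \<Rightarrow> (complex^'n^'n) set \<Rightarrow> (complex^'n^'n) set" where
  "conj_algebra u C = (\<lambda>d. u ** d ** madj u) ` C"

subsection \<open>Operators on the matrix algebra\<close>

definition superops :: "(complex^'n^'n \<Rightarrow> complex^'n^'n) set" where
  "superops = {T. Vector_Spaces.linear cscale cscale T}"

definition superop_adj ::
    "(complex^'n^'n \<Rightarrow> complex^'n^'n) \<Rightarrow> complex^'n^'n \<Rightarrow> complex^'n^'n" where
  "superop_adj T = (THE T'. \<forall>X Y. tau_inner (T' X) Y = tau_inner X (T Y))"

text \<open>
  The trace-preserving conditional expectation onto \<open>C\<close>: a trace-preserving positive linear
  \<open>C\<close>-bimodule projection onto \<open>C\<close>. The positive matrices are exactly those of the form \<open>Y\<^sup>*Y\<close>.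
\<close>

definition is_cond_exp :: "(complex^'n^'n) set \<Rightarrow> (complex^'n^'n \<Rightarrow> complex^'n^'n) \<Rightarrow> bool" where
  "is_cond_exp C E \<longleftrightarrow>
     E \<in> superops \<and>
     (\<forall>X. E X \<in> C) \<and>
     (\<forall>c\<in>C. E c = c) \<and>
     (\<forall>c\<in>C. \<forall>d\<in>C. \<forall>X. E (c ** X ** d) = c ** E X ** d) \<and>
     (\<forall>X :: complex^'n^'n. \<exists>Y :: complex^'n^'n. E (madj X ** X) = madj Y ** Y) \<and>
     (\<forall>X. trace (E X) = trace X)"

definition jones_proj :: "(complex^'n^'n) set \<Rightarrow> complex^'n^'n \<Rightarrow> complex^'n^'n" where
  "jones_proj C = (THE E. is_cond_exp C E)"

text \<open>
  \<open>x e\<^sub>1 y\<close> is the composite \<open>X \<mapsto> x e\<^sub>1(yX)\<close>, as matrices act by left multiplication.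
  Extensionality only fixes the irrelevant values of \<open>L\<close> on maps that are not linear.
\<close>

definition is_dual_cond_exp ::
    "((complex^'n^'n \<Rightarrow> complex^'n^'n) \<Rightarrow> complex^'n^'n) \<Rightarrow> bool" where
  "is_dual_cond_exp L \<longleftrightarrow>
     L \<in> extensional superops \<and>
     (\<forall>S\<in>superops. \<forall>T\<in>superops. L (\<lambda>X. S X + T X) = L S + L T) \<and>
     (\<forall>c. \<forall>S\<in>superops. L (\<lambda>X. cscale c (S X)) = cscale c (L S)) \<and>
     (\<forall>x y. L (\<lambda>X. x ** jones_proj scalar_algebra (y ** X))
            = cscale (1 / of_nat CARD('n) ^ 2) (x ** y))"

definition dual_cond_exp :: "(complex^'n^'n \<Rightarrow> complex^'n^'n) \<Rightarrow> complex^'n^'n" where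
  "dual_cond_exp = (THE L. is_dual_cond_exp L)"

definition superop_inner ::
    "(complex^'n^'n \<Rightarrow> complex^'n^'n) \<Rightarrow> (complex^'n^'n \<Rightarrow> complex^'n^'n) \<Rightarrow> complex^'n^'n" where
  "superop_inner S T = dual_cond_exp (superop_adj S \<circ> T)"

definition superop_norm :: "(complex^'n^'n \<Rightarrow> complex^'n^'n) \<Rightarrow> real" where
  "superop_norm S = sqrt (matrix_opnorm (superop_inner S S))"

subsection \<open>The interior angle\<close>

definition reduced_jones :: "(complex^'n^'n) set \<Rightarrow> complex^'n^'n \<Rightarrow> complex^'n^'n" where
  "reduced_jones C = (\<lambda>X. jones_proj C X - jones_proj scalar_algebra X)"

text \<open>Meaningful for unital \<open>C\<^sup>*\<close>-subalgebras other than \<open>scalar_algebra\<close>.\<close>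

definition interior_angle :: "(complex^'n^'n) set \<Rightarrow> (complex^'n^'n) set \<Rightarrow> real" where
  "interior_angle C D =
     (THE a. 0 \<le> a \<and> a \<le> pi / 2 \<and>
        cos a = matrix_opnorm (superop_inner (reduced_jones C) (reduced_jones D))
                / (superop_norm (reduced_jones C) * superop_norm (reduced_jones D)))"

subsection \<open>The definite descriptions above are well defined\<close>

lemma cscale_nth [simp]: "cscale c A $ i $ j = c * A $ i $ j"
  by (simp add: cscale_def)

lemma madj_nth [simp]: "madj A $ i $ j = cnj (A $ j $ i)"
  by (simp add: madj_def)

lemma vector_space_cscale: "vector_space cscale"
  by unfold_locales (auto simp: vec_eq_iff algebra_simps)

lemma superops_iff:
  "T \<in> superops \<longleftrightarrow> (\<forall>X Y. T (X + Y) = T X + T Y) \<and> (\<forall>c X. T (cscale c X) = cscale c (T X))"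
  using vector_space_cscale
  by (auto simp: superops_def Vector_Spaces.linear_iff)

lemma superops_sum:
  assumes "T \<in> superops"
  shows "T (\<Sum>i\<in>A. f i) = (\<Sum>i\<in>A. T (f i))"
proof -
  have 0: "T 0 = 0"
    using assms[unfolded superops_iff] by (metis add_cancel_right_right)
  show ?thesis
    by (induction A rule: infinite_finite_induct) (use 0 assms in \<open>auto simp: superops_iff\<close>)
qed

lemma cscale_mult_left: "cscale c A ** B = cscale c (A ** B)"
  by (simp add: vec_eq_iff matrix_matrix_mult_def sum_distrib_left mult.assoc)

lemma cscale_mult_right: "A ** cscale c B = cscale c (A ** B)"
  by (simp add: vec_eq_iff matrix_matrix_mult_def sum_distrib_left mult.left_commute)

lemma matrix_add_right_distrib: "(A + B) ** C = A ** C + B ** C" for A B :: "complex^'n^'m"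
  by (simp add: vec_eq_iff matrix_matrix_mult_def sum.distrib algebra_simps)

lemma mat_eq_cscale: "mat c = cscale c (mat 1)"
  by (simp add: vec_eq_iff mat_def)

lemma madj_mult: "madj (A ** B) = madj B ** madj A"
  by (simp add: vec_eq_iff matrix_matrix_mult_def mult.commute)

lemma madj_madj [simp]: "madj (madj A) = A"
  by (simp add: vec_eq_iff)

lemma tau_inner_sum:
  "tau_inner (X::complex^'n^'n) Y = (\<Sum>i\<in>UNIV. \<Sum>j\<in>UNIV. cnj (X $ j $ i) * Y $ j $ i) / of_nat CARD('n)"
  by (simp add: tau_inner_def trace_def matrix_matrix_mult_def)

lemma tau_inner_self_eq_0:
  assumes "tau_inner X X = 0"
  shows "X = 0"
proof -
  have "(\<Sum>i\<in>UNIV. \<Sum>j\<in>UNIV. complex_of_real ((cmod (X $ j $ i))\<^sup>2)) = 0"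
    using assms by (simp add: tau_inner_sum complex_norm_square mult.commute del: of_real_power)
  then have "complex_of_real (\<Sum>i\<in>UNIV. \<Sum>j\<in>UNIV. (cmod (X $ j $ i))\<^sup>2) = 0"
    by (simp only: of_real_sum)
  then have "(\<Sum>i\<in>UNIV. \<Sum>j\<in>UNIV. (cmod (X $ j $ i))\<^sup>2) = 0"
    using of_real_eq_0_iff by blast
  then have "\<forall>i j. (cmod (X $ j $ i))\<^sup>2 = 0"
    by (simp add: sum_nonneg_eq_0_iff sum_nonneg)
  then show ?thesis by (simp add: vec_eq_iff)
qed

lemma tau_inner_diff_left: "tau_inner (X - Y) Z = tau_inner X Z - tau_inner Y Z"
  by (simp add: tau_inner_sum algebra_simps sum_subtractf diff_divide_distrib)

lemma tau_inner_diff_right: "tau_inner X (Y - Z) = tau_inner X Y - tau_inner X Z"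
  by (simp add: tau_inner_sum algebra_simps sum_subtractf diff_divide_distrib)

lemma tau_inner_ext:
  assumes "\<And>Y. tau_inner X Y = tau_inner X' Y"
  shows "X = X'"
  using tau_inner_self_eq_0[of "X - X'"] assms by (simp add: tau_inner_diff_left)

definition munit :: "'n \<Rightarrow> 'n \<Rightarrow> complex^'n^'n" where
  "munit k l = (\<chi> i j. if i = k \<and> j = l then 1 else 0)"

lemma matrix_decomp: "X = (\<Sum>k\<in>UNIV. \<Sum>l\<in>UNIV. cscale (X $ k $ l) (munit k l))"
proof -
  have "(\<Sum>k\<in>UNIV. \<Sum>l\<in>UNIV. cscale (X $ k $ l) (munit k l)) $ i $ j = X $ i $ j" for i j
  proof -
    have "(\<Sum>l\<in>UNIV. X $ k $ l * (if i = k \<and> j = l then 1 else 0))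
        = (if i = k then X $ k $ j else 0)" for k
      by (auto simp: if_distrib cong: if_cong)
    then show ?thesis by (simp add: munit_def)
  qed
  then show ?thesis by (simp add: vec_eq_iff)
qed

lemma superop_adj_unique:
  assumes "\<And>X Y. tau_inner (T' X) Y = tau_inner X (T Y)"
  shows "superop_adj T = T'"
  unfolding superop_adj_def
proof (rule the_equality)
  show "T'' = T'" if "\<forall>X Y. tau_inner (T'' X) Y = tau_inner X (T Y)" for T''
    using that assms by (intro ext tau_inner_ext) simp
qed (use assms in blast)

lemma superop_adj:
  assumes "T \<in> superops"
  shows "tau_inner (superop_adj T X) Y = tau_inner X (T Y)"
proof -
  define T' where "T' X = (\<chi> k l. cnj (of_nat CARD('a) * tau_inner X (T (munit k l))))"
    for X :: "complex^'a^'a"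
  have *: "tau_inner (T' X) Y = tau_inner X (T Y)" for X Y
  proof -
    have "T Y = (\<Sum>k\<in>UNIV. \<Sum>l\<in>UNIV. cscale (Y $ k $ l) (T (munit k l)))"
      by (subst matrix_decomp[of Y])
        (use assms in \<open>simp add: superops_sum superops_iff\<close>)
    moreover have "tau_inner X (\<Sum>i\<in>A. f i) = (\<Sum>i\<in>A. tau_inner X (f i))"
      for f :: "'a \<Rightarrow> _" and A
      by (induction A rule: infinite_finite_induct)
        (auto simp: tau_inner_sum algebra_simps sum.distrib add_divide_distrib)
    moreover have "tau_inner X (cscale c Z) = c * tau_inner X Z" for c Z
      by (simp add: tau_inner_sum sum_distrib_left mult.left_commute)
    ultimately have "tau_inner X (T Y) =
        (\<Sum>k\<in>UNIV. \<Sum>l\<in>UNIV. Y $ k $ l * tau_inner X (T (munit k l)))"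
      by simp
    also have "\<dots> = tau_inner (T' X) Y"
      unfolding tau_inner_sum[of "T' X"]
      by (subst sum.swap) (simp add: T'_def sum_divide_distrib mult.commute)
    finally show ?thesis by simp
  qed
  then show ?thesis using superop_adj_unique[of T' T] by simp
qed

lemma is_cond_exp_orthogonal:
  assumes "is_cond_exp C E" "unital_cstar_subalgebra C" "c \<in> C"
  shows "tau_inner c (E X) = tau_inner c X"
proof -
  have "madj c \<in> C" "mat 1 \<in> C"
    using assms by (auto simp: unital_cstar_subalgebra_def)
  then have "E (madj c ** X ** mat 1) = madj c ** E X ** mat 1"
    using assms(1) unfolding is_cond_exp_def by blast
  then have "madj c ** E X = E (madj c ** X)" by simp
  then show ?thesis
    using assms(1) by (simp add: tau_inner_def is_cond_exp_def)
qed

lemma is_cond_exp_unique: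
  assumes C: "unital_cstar_subalgebra C" and "is_cond_exp C E" "is_cond_exp C F"
  shows "E = F"
proof
  fix X
  have E: "E X \<in> C" "F X \<in> C" using assms by (auto simp: is_cond_exp_def)
  have "E X - F X = E X + cscale (-1) (F X)" by (simp add: vec_eq_iff)
  moreover have "E X + cscale (-1) (F X) \<in> C"
    using E C unfolding unital_cstar_subalgebra_def by blast
  ultimately have "E X - F X \<in> C" by metis
  then have "tau_inner (E X - F X) (E X - F X) = 0"
    using is_cond_exp_orthogonal[OF assms(2) C] is_cond_exp_orthogonal[OF assms(3) C]
    by (simp add: tau_inner_diff_right)
  then show "E X = F X" using tau_inner_self_eq_0 by fastforce
qed

lemma jones_proj_eq:
  assumes "unital_cstar_subalgebra C" "is_cond_exp C E"
  shows "jones_proj C = E"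
  unfolding jones_proj_def using assms is_cond_exp_unique by blast

lemma mat_mult_mat: "mat a ** mat b = (mat (a * b) :: complex^'n^'n)"
  by (subst (1 2) mat_eq_cscale)
    (simp add: cscale_mult_left cscale_mult_right, simp add: vec_eq_iff mat_def)

lemma madj_mat: "madj (mat a) = (mat (cnj a) :: complex^'n^'n)"
  by (auto simp: vec_eq_iff mat_def)

lemma scalar_algebra_subalgebra: "unital_cstar_subalgebra (scalar_algebra :: (complex^'n^'n) set)"
proof -
  have "mat a + mat b = (mat (a + b) :: complex^'n^'n)"
    "cscale a (mat b) = (mat (a * b) :: complex^'n^'n)" for a b
    by (auto simp: vec_eq_iff mat_def)
  then show ?thesis
    by (auto simp: mat_mult_mat madj_mat unital_cstar_subalgebra_def scalar_algebra_def)
qed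

lemma jones_proj_scalar:
  "jones_proj scalar_algebra (X::complex^'n^'n) = mat (trace X / of_nat CARD('n))"
proof -
  let ?E = "\<lambda>X::complex^'n^'n. mat (trace X / of_nat CARD('n)) :: complex^'n^'n"
  have tr: "trace (mat c :: complex^'n^'n) = of_nat CARD('n) * c" for c
    by (simp add: trace_def mat_def)
  have tr_scale: "trace (cscale c X) = c * trace X" for c and X :: "complex^'n^'n"
    by (simp add: trace_def sum_distrib_left)
  have 1: "?E \<in> superops"
    by (auto simp: superops_iff tr_scale trace_add add_divide_distrib vec_eq_iff mat_def)
  have 2: "?E (mat a ** X ** mat b) = mat a ** ?E X ** mat b" for a b X
  proof -
    have "mat a ** X ** mat b = cscale (a * b) X" for X :: "complex^'n^'n"
      by (subst (1 2) mat_eq_cscale)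
        (simp add: cscale_mult_left cscale_mult_right, simp add: vec_eq_iff)
    then show ?thesis by (simp add: tr_scale) (simp add: vec_eq_iff mat_def)
  qed
  have 3: "\<exists>Y::complex^'n^'n. ?E (madj X ** X) = madj Y ** Y" for X :: "complex^'n^'n"
  proof -
    have "trace (madj X ** X) = of_real (\<Sum>i\<in>UNIV. \<Sum>j\<in>UNIV. (cmod (X $ j $ i))\<^sup>2)"
      by (simp add: trace_def matrix_matrix_mult_def of_real_sum complex_norm_square mult.commute
               del: of_real_power)
    moreover have "(\<Sum>i\<in>UNIV. \<Sum>j\<in>UNIV. (cmod (X $ j $ i))\<^sup>2) \<ge> 0"
      by (intro sum_nonneg) auto
    ultimately obtain s where s: "s \<ge> 0"
      "trace (madj X ** X) / of_nat CARD('n) = complex_of_real s"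
      by (metis divide_nonneg_nonneg of_nat_0_le_iff of_real_divide of_real_of_nat_eq)
    have "mat (of_real s) = madj (mat (of_real (sqrt s))) ** (mat (of_real (sqrt s)) :: complex^'n^'n)"
      using s by (simp add: madj_mat mat_mult_mat flip: of_real_mult)
    then show ?thesis unfolding s(2) by blast
  qed
  have "is_cond_exp scalar_algebra ?E"
    using 1 2 3 unfolding is_cond_exp_def scalar_algebra_def by (auto simp: tr)
  then show ?thesis
    using jones_proj_eq[OF scalar_algebra_subalgebra] by metis
qed

lemma jones_proj_scalar_munit:
  "jones_proj scalar_algebra (munit l k ** X) = mat (X $ k $ l / of_nat CARD('n))"
  for X :: "complex^'n^'n"
proof -
  have "trace (munit l k ** X) = (\<Sum>i\<in>UNIV. \<Sum>j\<in>UNIV. if i = l then if j = k then X $ j $ i else 0 else 0)"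
    unfolding trace_def matrix_matrix_mult_def munit_def by (auto intro!: sum.cong)
  also have "\<dots> = (\<Sum>i\<in>UNIV. if i = l then X $ k $ i else 0)"
    by (intro sum.cong) auto
  finally show ?thesis by (simp add: jones_proj_scalar)
qed

lemma superops_add: "S \<in> superops \<Longrightarrow> T \<in> superops \<Longrightarrow> (\<lambda>X. S X + T X) \<in> superops"
  by (auto simp: superops_iff vec_eq_iff algebra_simps)

lemma superops_cscale: "S \<in> superops \<Longrightarrow> (\<lambda>X. cscale c (S X)) \<in> superops"
  by (auto simp: superops_iff vec_eq_iff algebra_simps)

lemma superops_zero: "(\<lambda>X. 0) \<in> superops"
  by (auto simp: superops_iff vec_eq_iff)

lemma superops_setsum:
  "(\<And>i. i \<in> A \<Longrightarrow> S i \<in> superops) \<Longrightarrow> (\<lambda>X. \<Sum>i\<in>A. S i X) \<in> superops"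
  by (induction A rule: infinite_finite_induct) (auto simp: superops_add superops_zero)

lemma xe1y_eq:
  "x ** jones_proj scalar_algebra (y ** X) = cscale (trace (y ** X) / of_nat CARD('n)) x"
  for x y X :: "complex^'n^'n"
  by (simp only: jones_proj_scalar mat_eq_cscale[of "_ / _"] cscale_mult_right matrix_mul_rid)

lemma xe1y_superops: "(\<lambda>X. x ** jones_proj scalar_algebra (y ** X)) \<in> superops"
proof -
  have "trace (cscale c X) = c * trace X" for c and X :: "complex^'n^'n"
    by (simp add: trace_def sum_distrib_left)
  then show ?thesis
    by (auto simp: superops_iff xe1y_eq matrix_add_ldistrib cscale_mult_right trace_add
          vec_eq_iff add_divide_distrib ring_distribs)
qed

lemma superop_decomp:
  fixes S :: "complex^'n^'n \<Rightarrow> complex^'n^'n"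
  assumes "S \<in> superops"
  shows "S = (\<lambda>X. \<Sum>k\<in>UNIV. \<Sum>l\<in>UNIV.
    cscale (of_nat CARD('n)) (S (munit k l) ** jones_proj scalar_algebra (munit l k ** X)))"
proof
  fix X
  have "S X = (\<Sum>k\<in>UNIV. \<Sum>l\<in>UNIV. cscale (X $ k $ l) (S (munit k l)))"
    by (subst matrix_decomp[of X]) (use assms in \<open>simp add: superops_sum superops_iff\<close>)
  moreover have "cscale (X $ k $ l) (S (munit k l)) =
    cscale (of_nat CARD('n)) (S (munit k l) ** jones_proj scalar_algebra (munit l k ** X))" for k l
    by (simp only: jones_proj_scalar_munit mat_eq_cscale[of "_ / _"] cscale_mult_right matrix_mul_rid)
      (simp add: vec_eq_iff)
  ultimately show "S X = (\<Sum>k\<in>UNIV. \<Sum>l\<in>UNIV.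
    cscale (of_nat CARD('n)) (S (munit k l) ** jones_proj scalar_algebra (munit l k ** X)))" by simp
qed

definition dual_formula :: "(complex^'n^'n \<Rightarrow> complex^'n^'n) \<Rightarrow> complex^'n^'n" where
  "dual_formula S =
     cscale (1 / of_nat CARD('n)) (\<Sum>k\<in>UNIV. \<Sum>l\<in>UNIV. S (munit k l) ** munit l k)"

lemma is_dual_cond_exp_apply:
  fixes S :: "complex^'n^'n \<Rightarrow> complex^'n^'n"
  assumes L: "is_dual_cond_exp L" and S: "S \<in> superops"
  shows "L S = dual_formula S"
proof -
  define e where "e k l = (\<lambda>X. S (munit k l) ** jones_proj scalar_algebra (munit l k ** X))" for k l
  have e: "e k l \<in> superops" for k l
    unfolding e_def by (rule xe1y_superops)
  have Le: "L (e k l) = cscale (1 / of_nat CARD('n) ^ 2) (S (munit k l) ** munit l k)" for k l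
    using L unfolding is_dual_cond_exp_def e_def by blast
  have add: "L (\<lambda>X. F X + G X) = L F + L G" if "F \<in> superops" "G \<in> superops" for F G
    using L that unfolding is_dual_cond_exp_def by blast
  have scale: "L (\<lambda>X. cscale c (F X)) = cscale c (L F)" if "F \<in> superops" for c F
    using L that unfolding is_dual_cond_exp_def by blast
  have "L (\<lambda>X. 0) = 0"
    using add[OF superops_zero superops_zero] by simp
  then have sum: "L (\<lambda>X. \<Sum>i\<in>A. F i X) = (\<Sum>i\<in>A. L (F i))"
    if "\<And>i. F i \<in> superops" for F and A :: "'n set"
    by (induction A rule: infinite_finite_induct) (simp_all add: add that superops_setsum)
  have "L S = L (\<lambda>X. \<Sum>k\<in>UNIV. \<Sum>l\<in>UNIV. cscale (of_nat CARD('n)) (e k l X))"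
    using superop_decomp[OF S] unfolding e_def by simp
  also have "\<dots> = (\<Sum>k\<in>UNIV. \<Sum>l\<in>UNIV. cscale (of_nat CARD('n)) (L (e k l)))"
    by (simp add: sum superops_setsum superops_cscale e scale)
  also have "\<dots> = dual_formula S"
    by (simp add: Le dual_formula_def vec_eq_iff sum_distrib_left power2_eq_square)
  finally show ?thesis .
qed

lemma is_dual_cond_exp_dual_formula: "is_dual_cond_exp (restrict dual_formula superops)"
proof -
  have 1: "dual_formula (\<lambda>X. S X + T X) = dual_formula S + dual_formula T"
    for S T :: "complex^'n^'n \<Rightarrow> complex^'n^'n"
    by (simp add: dual_formula_def matrix_add_right_distrib sum.distrib)
      (simp add: vec_eq_iff algebra_simps)
  have 2: "dual_formula (\<lambda>X. cscale c (S X)) = cscale c (dual_formula S)"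
    for c and S :: "complex^'n^'n \<Rightarrow> complex^'n^'n"
    by (simp add: dual_formula_def cscale_mult_left) (simp add: vec_eq_iff sum_distrib_left algebra_simps)
  have 3: "dual_formula (\<lambda>X. x ** jones_proj scalar_algebra (y ** X))
      = cscale (1 / of_nat CARD('n) ^ 2) (x ** y)" for x y :: "complex^'n^'n"
  proof -
    have tr: "trace (y ** munit k l) = y $ l $ k" for k l
    proof -
      have "trace (y ** munit k l) =
          (\<Sum>i\<in>UNIV. \<Sum>j\<in>UNIV. if i = l then if j = k then y $ i $ j else 0 else 0)"
        unfolding trace_def matrix_matrix_mult_def munit_def by (auto intro!: sum.cong)
      also have "\<dots> = (\<Sum>i\<in>UNIV. if i = l then y $ i $ k else 0)"
        by (intro sum.cong) auto
      finally show ?thesis by simp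
    qed
    have sum_mult: "x ** (\<Sum>i\<in>A. f i) = (\<Sum>i\<in>A. x ** f i)" for f :: "'n \<Rightarrow> complex^'n^'n" and A
      by (induction A rule: infinite_finite_induct) (simp_all add: matrix_add_ldistrib)
    have "(\<Sum>k\<in>UNIV. \<Sum>l\<in>UNIV. cscale (y $ l $ k / of_nat CARD('n)) x ** munit l k)
        = cscale (1 / of_nat CARD('n)) (x ** (\<Sum>l\<in>UNIV. \<Sum>k\<in>UNIV. cscale (y $ l $ k) (munit l k)))"
      by (subst sum.swap)
        (simp add: sum_mult cscale_mult_left cscale_mult_right, simp add: vec_eq_iff sum_distrib_left)
    then show ?thesis
      by (simp add: dual_formula_def xe1y_eq tr flip: matrix_decomp)
        (simp add: vec_eq_iff power2_eq_square)
  qed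
  show ?thesis
    unfolding is_dual_cond_exp_def
    by (auto simp: 1 2 3 superops_add superops_cscale xe1y_superops)
qed

lemma dual_cond_exp_eq: "dual_cond_exp = restrict dual_formula superops"
  unfolding dual_cond_exp_def
proof (rule the_equality[where a = "restrict dual_formula superops"])
  show "L = restrict dual_formula superops" if "is_dual_cond_exp L"
    for L :: "(complex^'n^'n \<Rightarrow> complex^'n^'n) \<Rightarrow> complex^'n^'n"
    using that is_dual_cond_exp_apply[OF that]
    by (intro extensionalityI[of _ superops]) (auto simp: is_dual_cond_exp_def)
qed (rule is_dual_cond_exp_dual_formula)

lemma conj_diagonal_subalgebra:
  assumes u: "unitary_matrix u"
  shows "unital_cstar_subalgebra (conj_algebra u diagonal_algebra)"
proof -
  have uu: "madj u ** (u ** X) = X" for X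
    using u by (simp add: matrix_mul_assoc unitary_matrix_def)
  have D: "madj x \<in> diagonal_algebra" "x + y \<in> diagonal_algebra"
    "cscale c x \<in> diagonal_algebra" "x ** y \<in> diagonal_algebra"
    if "x \<in> diagonal_algebra" "y \<in> diagonal_algebra" for c and x y :: "complex^'n^'n"
    using that
    by (auto simp: diagonal_algebra_def mat_def matrix_matrix_mult_def intro!: sum.neutral) metis
  have "mat 1 = u ** mat 1 ** madj u"
    using u by (simp add: unitary_matrix_def)
  moreover have "mat 1 \<in> diagonal_algebra"
    by (simp add: diagonal_algebra_def mat_def)
  ultimately have "mat 1 \<in> conj_algebra u diagonal_algebra"
    unfolding conj_algebra_def by (rule image_eqI)
  moreover have "u ** x ** madj u + u ** y ** madj u = u ** (x + y) ** madj u"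
    "(u ** x ** madj u) ** (u ** y ** madj u) = u ** (x ** y) ** madj u"
    "cscale c (u ** x ** madj u) = u ** cscale c x ** madj u"
    "madj (u ** x ** madj u) = u ** madj x ** madj u" for x y c
    by (simp_all add: matrix_add_ldistrib matrix_add_right_distrib cscale_mult_left cscale_mult_right
          madj_mult uu flip: matrix_mul_assoc)
  ultimately show ?thesis
    using D unfolding unital_cstar_subalgebra_def conj_algebra_def
    by (auto intro!: imageI)
qed

lemma conj_diagonal_nontrivial:
  fixes u :: "complex^'n^'n"
  assumes u: "unitary_matrix u" and n: "CARD('n) \<ge> 2"
  shows "conj_algebra u diagonal_algebra \<noteq> scalar_algebra"
proof
  assume eq: "conj_algebra u diagonal_algebra = scalar_algebra"
  obtain k l :: 'n where kl: "k \<noteq> l"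
    using n by (metis (full_types) card_2_iff' card_le_Suc0_iff_eq finite not_less_eq_eq numeral_2_eq_2 UNIV_I)
  have "munit k k \<in> diagonal_algebra" by (auto simp: diagonal_algebra_def munit_def)
  then obtain c where "u ** munit k k ** madj u = mat c"
    using eq by (force simp: conj_algebra_def scalar_algebra_def)
  then have "madj u ** (u ** munit k k ** madj u) ** u = madj u ** mat c ** u" by simp
  moreover have "madj u ** (u ** munit k k ** madj u) ** u = (madj u ** u) ** munit k k ** (madj u ** u)"
    by (simp add: matrix_mul_assoc)
  moreover have "madj u ** mat c ** u = cscale c (madj u ** u)"
    by (subst mat_eq_cscale) (simp add: cscale_mult_left cscale_mult_right)
  ultimately have "munit k k = cscale c (mat 1 :: complex^'n^'n)"
    using u by (simp add: unitary_matrix_def)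
  then have "(munit k k :: complex^'n^'n) $ k $ k = cscale c (mat 1) $ k $ k"
    "(munit k k :: complex^'n^'n) $ l $ l = cscale c (mat 1) $ l $ l" by simp_all
  then show False using kl by (simp add: munit_def mat_def)
qed

end

theory Submission
  imports Defs
begin

text \<open>
  With \<open>p\<^sub>i\<close> and \<open>q\<^sub>j\<close> the minimal projections of the diagonal algebra and of its conjugate by a
  unitary \<open>v\<close>, the dual conditional expectation gives
  \<open>cos \<alpha> = \<parallel>n \<Sum>\<^sub>i\<^sub>j Tr(p\<^sub>i q\<^sub>j) p\<^sub>i q\<^sub>j - 1\<parallel> / (n - 1)\<close>, which is continuous in \<open>v\<close>. It is \<open>1\<close> at \<open>v = 1\<close>
  and vanishes when all entries of \<open>v\<close> have the same modulus. With \<open>F\<close> the Fourier matrix, the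
  unitary circulants \<open>F diag(exp(\<i> t \<theta>\<^sub>j)) F\<^sup>*\<close> connect these two cases: the phases
  \<open>\<theta>\<^sub>j = \<pi> j (j + n) / n\<close> form a quadratic chirp, so that the entries at \<open>t = 1\<close> are Gauss sums, all
  of the same modulus. The intermediate value theorem does the rest.
\<close>

subsection \<open>The conditional expectation onto a conjugate of the diagonal algebra\<close>

definition diag_part :: "complex^'n^'n \<Rightarrow> complex^'n^'n" where
  "diag_part X = (\<chi> i j. if i = j then X $ i $ j else 0)"

lemma diag_part_nth: "diag_part X $ i $ j = (if i = j then X $ i $ j else 0)"
  by (simp add: diag_part_def)

lemma diag_mult_nth:
  assumes "d \<in> diagonal_algebra"
  shows "(d ** X) $ i $ j = d $ i $ i * X $ i $ j" "(X ** d) $ i $ j = X $ i $ j * d $ j $ j"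
proof -
  have "(d ** X) $ i $ j = (\<Sum>k\<in>UNIV. if k = i then d $ i $ i * X $ i $ j else 0)"
    unfolding matrix_matrix_mult_def vec_lambda_beta using assms
    by (intro sum.cong) (auto simp: diagonal_algebra_def)
  then show "(d ** X) $ i $ j = d $ i $ i * X $ i $ j" by simp
  have "(X ** d) $ i $ j = (\<Sum>k\<in>UNIV. if k = j then X $ i $ j * d $ j $ j else 0)"
    unfolding matrix_matrix_mult_def vec_lambda_beta using assms
    by (intro sum.cong) (auto simp: diagonal_algebra_def)
  then show "(X ** d) $ i $ j = X $ i $ j * d $ j $ j" by simp
qed

lemma diag_part_diagonal: "diag_part X \<in> diagonal_algebra"
  by (simp add: diagonal_algebra_def diag_part_nth)

lemma diag_part_fixed: "d \<in> diagonal_algebra \<Longrightarrow> diag_part d = d"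
  by (auto simp: diagonal_algebra_def diag_part_nth vec_eq_iff)

lemma diag_part_bimodule:
  assumes "c \<in> diagonal_algebra" "d \<in> diagonal_algebra"
  shows "diag_part (c ** X ** d) = c ** diag_part X ** d"
  by (simp add: vec_eq_iff diag_part_nth diag_mult_nth[OF assms(1)] diag_mult_nth[OF assms(2)])

text \<open>The diagonal of \<open>madj X ** X\<close> lists the squared column norms of
  \<open>X\<close>. They are nonnegative, so the diagonal matrix of column norms serves as
  \<open>Y\<close>.\<close>

lemma diag_part_positive:
  fixes X :: "complex^'n^'n"
  obtains Y :: "complex^'n^'n" where "diag_part (madj X ** X) = madj Y ** Y"
proof
  define Y :: "complex^'n^'n" where
    "Y = (\<chi> i j. if i = j then of_real (sqrt (\<Sum>k\<in>UNIV. (cmod (X $ k $ i))\<^sup>2)) else 0)"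
  have Y: "Y \<in> diagonal_algebra"
    by (simp add: Y_def diagonal_algebra_def)
  have "(madj X ** X) $ i $ i = of_real (\<Sum>k\<in>UNIV. (cmod (X $ k $ i))\<^sup>2)" for i
    by (simp add: matrix_matrix_mult_def complex_norm_square mult.commute del: of_real_power)
  moreover have "(madj Y ** Y) $ i $ j =
      (if i = j then of_real (\<Sum>k\<in>UNIV. (cmod (X $ k $ i))\<^sup>2) else 0)" for i j
    unfolding diag_mult_nth(2)[OF Y]
    by (simp add: Y_def sum_nonneg flip: of_real_mult)
  ultimately show "diag_part (madj X ** X) = madj Y ** Y"
    by (simp add: vec_eq_iff diag_part_nth)
qed

definition conj_expectation :: "complex^'n^'n \<Rightarrow> complex^'n^'n \<Rightarrow> complex^'n^'n" where
  "conj_expectation v X = v ** diag_part (madj v ** X ** v) ** madj v"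

lemma trace_conj:
  fixes v :: "complex^'n^'n"
  assumes "madj v ** v = mat 1"
  shows "trace (v ** X ** madj v) = trace X"
  by (metis assms matrix_mul_assoc matrix_mul_rid trace_mul_sym)

text \<open>Conjugation by \<open>v\<close> carries each clause back to the corresponding fact about
  \<open>diag_part\<close>.\<close>

lemma conj_expectation_cond_exp:
  fixes v :: "complex^'n^'n"
  assumes v: "unitary_matrix v"
  shows "is_cond_exp (conj_algebra v diagonal_algebra) (conj_expectation v)"
proof -
  have v1: "madj v ** v = mat 1" and v2: "v ** madj v = mat 1"
    using v by (auto simp: unitary_matrix_def)
  have cancel: "madj v ** (v ** X) = X" "v ** (madj v ** X) = X" for X
    by (simp_all add: matrix_mul_assoc v1 v2)
  have 1: "conj_expectation v \<in> superops"
  proof -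
    have "diag_part (X + Y) = diag_part X + diag_part Y"
      "diag_part (cscale c X) = cscale c (diag_part X)" for c and X Y :: "complex^'n^'n"
      by (auto simp: vec_eq_iff diag_part_nth)
    then show ?thesis
      by (simp add: superops_iff conj_expectation_def matrix_add_ldistrib matrix_add_right_distrib
          cscale_mult_left cscale_mult_right)
  qed
  have 2: "conj_expectation v X \<in> conj_algebra v diagonal_algebra" for X
    unfolding conj_expectation_def conj_algebra_def using diag_part_diagonal by blast
  have 3: "conj_expectation v c = c" if "c \<in> conj_algebra v diagonal_algebra" for c
    using that
    by (auto simp: conj_expectation_def conj_algebra_def cancel v1 diag_part_fixed
        simp flip: matrix_mul_assoc)
  have 4: "conj_expectation v (c ** X ** d) = c ** conj_expectation v X ** d"
    if cd: "c \<in> conj_algebra v diagonal_algebra" "d \<in> conj_algebra v diagonal_algebra" for c d X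
  proof -
    obtain c' d' where c': "c = v ** c' ** madj v" "c' \<in> diagonal_algebra"
      and d': "d = v ** d' ** madj v" "d' \<in> diagonal_algebra"
      using cd by (auto simp: conj_algebra_def)
    have "madj v ** (c ** X ** d) ** v = c' ** (madj v ** X ** v) ** d'"
      by (simp add: c' d' cancel v1 flip: matrix_mul_assoc)
    then have "conj_expectation v (c ** X ** d)
        = v ** (c' ** diag_part (madj v ** X ** v) ** d') ** madj v"
      by (simp add: conj_expectation_def diag_part_bimodule[OF c'(2) d'(2)])
    then show ?thesis
      by (simp add: conj_expectation_def c' d' cancel flip: matrix_mul_assoc)
  qed
  have 5: "\<exists>Y::complex^'n^'n. conj_expectation v (madj X ** X) = madj Y ** Y"
    for X :: "complex^'n^'n"
  proof -
    \<comment> \<open>Conjugating \<open>madj X ** X\<close> by \<open>v\<close> gives the same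
      expression for \<open>X ** v\<close>, so positivity of \<open>diag_part\<close>
      applies.\<close>
    obtain Y :: "complex^'n^'n" where "diag_part (madj (X ** v) ** (X ** v)) = madj Y ** Y"
      using diag_part_positive .
    then have "conj_expectation v (madj X ** X) = madj (Y ** madj v) ** (Y ** madj v)"
      by (simp add: conj_expectation_def madj_mult matrix_mul_assoc)
    then show ?thesis by blast
  qed
  have 6: "trace (conj_expectation v X) = trace X" for X
  proof -
    have "trace (diag_part Z) = trace Z" for Z :: "complex^'n^'n"
      by (simp add: trace_def diag_part_nth)
    then show ?thesis
      using trace_conj[of "madj v" X] by (simp add: conj_expectation_def trace_conj v1 v2)
  qed
  show ?thesis
    unfolding is_cond_exp_def using 1 2 3 4 5 6 by blast
qed

lemma conj_expectation_nth:
  "conj_expectation v X $ a $ b =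
     (\<Sum>j\<in>UNIV. v $ a $ j * (madj v ** X ** v) $ j $ j * cnj (v $ b $ j))"
  unfolding conj_expectation_def matrix_matrix_mult_def[of "v ** _"]
  by (simp add: diag_mult_nth[OF diag_part_diagonal] diag_part_nth)

text \<open>Matrix units are the arguments on which \<open>dual_formula\<close> evaluates an
  operator.\<close>

lemma conj_munit_diag_nth:
  "(madj v ** munit b l ** v) $ j $ j = cnj (v $ b $ j) * v $ l $ j"
proof -
  have "(madj v ** munit b l) $ j $ k = (if k = l then cnj (v $ b $ j) else 0)" for k
  proof -
    have "(madj v ** munit b l) $ j $ k
        = (\<Sum>i\<in>UNIV. if i = b then if k = l then cnj (v $ b $ j) else 0 else 0)"
      unfolding matrix_matrix_mult_def munit_def vec_lambda_beta by (intro sum.cong) auto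
    then show ?thesis by simp
  qed
  then have "(madj v ** munit b l ** v) $ j $ j
      = (\<Sum>k\<in>UNIV. if k = l then cnj (v $ b $ j) * v $ l $ j else 0)"
    unfolding matrix_matrix_mult_def[of "madj v ** munit b l"] vec_lambda_beta by (intro sum.cong) auto
  then show ?thesis by simp
qed

subsection \<open>The inner product of reduced Jones projections\<close>

text \<open>Both sides equal \<open>tau_inner (E X) (E Y)\<close>: \<open>E Z - Z\<close> is
  orthogonal to \<open>C\<close>, and Hermitian symmetry covers the other argument.\<close>

lemma is_cond_exp_self_adjoint:
  assumes "is_cond_exp C E" "unital_cstar_subalgebra C"
  shows "tau_inner (E X) Y = tau_inner X (E Y)"
proof -
  have sym: "tau_inner A B = cnj (tau_inner B A)" for A B :: "complex^'n^'n"
    by (simp add: tau_inner_sum mult.commute)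
  have "E Z \<in> C" for Z using assms(1) by (simp add: is_cond_exp_def)
  then have "tau_inner (E X) Y = tau_inner (E X) (E Y)" "tau_inner (E Y) X = tau_inner (E Y) (E X)"
    using is_cond_exp_orthogonal[OF assms] by auto
  then show ?thesis by (metis sym)
qed

lemma jones_proj_scalar_self_adjoint:
  fixes X Y :: "complex^'n^'n"
  shows "tau_inner (jones_proj scalar_algebra X) Y = tau_inner X (jones_proj scalar_algebra Y)"
proof -
  have "mat c ** Z = cscale c Z" "Z ** mat c = cscale c Z" for c and Z :: "complex^'n^'n"
    by (simp_all add: mat_eq_cscale[of c] cscale_mult_left cscale_mult_right)
  moreover have "trace (cscale c Z) = c * trace Z" "trace (madj Z) = cnj (trace Z)"
    for c and Z :: "complex^'n^'n"
    by (simp_all add: trace_def sum_distrib_left)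
  ultimately have "tau_inner (mat c) Z = cnj c * trace Z / of_nat CARD('n)"
    "tau_inner Z (mat c) = c * cnj (trace Z) / of_nat CARD('n)" for c and Z :: "complex^'n^'n"
    by (simp_all add: tau_inner_def madj_mat)
  then show ?thesis
    by (simp add: jones_proj_scalar)
qed

text \<open>Right multiplication by \<open>munit l k\<close> moves column \<open>l\<close> to column
  \<open>k\<close>, so only \<open>k = b\<close> contributes to column \<open>b\<close>.\<close>

lemma dual_formula_nth:
  fixes T :: "complex^'n^'n \<Rightarrow> complex^'n^'n"
  shows "dual_formula T $ a $ b = (\<Sum>l\<in>UNIV. T (munit b l) $ a $ l) / of_nat CARD('n)"
proof -
  have "(T (munit k l) ** munit l k) $ a $ b = (if k = b then T (munit b l) $ a $ l else 0)" for k l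
  proof -
    have "(T (munit k l) ** munit l k) $ a $ b =
        (\<Sum>i\<in>UNIV. if i = l then if k = b then T (munit b l) $ a $ l else 0 else 0)"
      unfolding matrix_matrix_mult_def munit_def[of l k] vec_lambda_beta by (intro sum.cong) auto
    then show ?thesis by simp
  qed
  then show ?thesis
    by (simp add: dual_formula_def) (subst sum.swap, simp)
qed

lemma dual_formula_diff:
  "dual_formula (\<lambda>X. S X - T X) = dual_formula S - dual_formula T"
  by (simp add: vec_eq_iff dual_formula_nth sum_subtractf diff_divide_distrib)

lemma dual_formula_scalar:
  "dual_formula (jones_proj scalar_algebra :: complex^'n^'n \<Rightarrow> complex^'n^'n)
     = mat (1 / of_nat CARD('n) ^ 2)"
proof -
  have "trace (munit b l :: complex^'n^'n) = (if b = l then 1 else 0)" for b l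
  proof -
    have "trace (munit b l :: complex^'n^'n) = (\<Sum>i\<in>UNIV. if i = b then if b = l then 1 else 0 else 0)"
      unfolding trace_def munit_def vec_lambda_beta by (intro sum.cong) auto
    then show ?thesis by simp
  qed
  then show ?thesis
    by (simp add: vec_eq_iff dual_formula_nth jones_proj_scalar mat_def power2_eq_square
        if_distrib[of "\<lambda>x. x / _"] cong: if_cong)
qed

text \<open>Let \<open>J\<close> be the scalar Jones projection. The reduced projections are
  self-adjoint, and \<open>E J = J F = J J = J\<close>, so the product
  \<open>(E - J) (F - J)\<close> collapses to \<open>E F - J\<close>.\<close>

lemma superop_inner_reduced_jones:
  fixes C D :: "(complex^'n^'n) set"
  assumes C: "unital_cstar_subalgebra C" "is_cond_exp C E"
    and D: "unital_cstar_subalgebra D" "is_cond_exp D F"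
  shows "superop_inner (reduced_jones C) (reduced_jones D)
    = dual_formula (E \<circ> F) - mat (1 / of_nat CARD('n) ^ 2)"
proof -
  let ?J = "jones_proj scalar_algebra :: complex^'n^'n \<Rightarrow> complex^'n^'n"
  have red: "reduced_jones C = (\<lambda>X. E X - ?J X)" "reduced_jones D = (\<lambda>X. F X - ?J X)"
    by (simp_all add: reduced_jones_def jones_proj_eq[OF C] jones_proj_eq[OF D])
  have ops: "E \<in> superops" "F \<in> superops"
    using C D by (auto simp: is_cond_exp_def)
  \<comment> \<open>\<open>J\<close> is the operator \<open>x e_1 y\<close> with
    \<open>x = y = 1\<close>.\<close>
  have J: "?J \<in> superops"
    using xe1y_superops[of "mat 1 :: complex^'n^'n" "mat 1"] by simp
  have diff: "T (X - Y) = T X - T Y" if "T \<in> superops" for T :: "complex^'n^'n \<Rightarrow> complex^'n^'n" and X Y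
    using that by (metis superops_iff diff_add_cancel add_diff_cancel)
  have EJ: "E (?J X) = ?J X" for X
  proof -
    have "?J X = cscale (trace X / of_nat CARD('n)) (mat 1)"
      by (simp only: jones_proj_scalar flip: mat_eq_cscale)
    then have "?J X \<in> C"
      using C(1) by (simp add: unital_cstar_subalgebra_def)
    then show ?thesis using C(2) by (simp add: is_cond_exp_def)
  qed
  \<comment> \<open>\<open>J\<close> sees only the trace, which \<open>F\<close> and
    \<open>J\<close> preserve.\<close>
  have JF: "?J (F X) = ?J X" "?J (?J X) = ?J X" for X
    using D(2) by (simp_all add: jones_proj_scalar is_cond_exp_def) (simp add: trace_def mat_def)
  have "superop_adj (reduced_jones C) = reduced_jones C"
    by (rule superop_adj_unique)
      (simp add: red tau_inner_diff_left tau_inner_diff_right is_cond_exp_self_adjoint[OF C(2,1)]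
        jones_proj_scalar_self_adjoint)
  then have "superop_adj (reduced_jones C) \<circ> reduced_jones D = (\<lambda>X. (E \<circ> F) X - ?J X)"
    by (simp add: red fun_eq_iff diff[OF ops(1)] diff[OF J] EJ JF)
  moreover have "(\<lambda>X. (E \<circ> F) X - ?J X) \<in> superops"
    using ops J by (simp add: superops_iff) (simp add: vec_eq_iff algebra_simps)
  ultimately show ?thesis
    by (simp add: superop_inner_def dual_cond_exp_eq dual_formula_diff dual_formula_scalar del: o_apply)
qed

text \<open>The value is independent of \<open>v\<close>, so both norms in the denominator of the
  angle agree. Idempotence leaves a single expectation to evaluate.\<close>

lemma superop_inner_reduced_self:
  fixes v :: "complex^'n^'n"
  assumes v: "unitary_matrix v"
  defines "C \<equiv> conj_algebra v diagonal_algebra"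
  shows "superop_inner (reduced_jones C) (reduced_jones C)
    = mat (1 / of_nat CARD('n) - 1 / of_nat CARD('n) ^ 2)"
proof -
  let ?E = "conj_expectation v"
  have C: "unital_cstar_subalgebra C" "is_cond_exp C ?E"
    unfolding C_def using v conj_diagonal_subalgebra conj_expectation_cond_exp by blast+
  have vv: "(\<Sum>j\<in>UNIV. v $ a $ j * cnj (v $ b $ j)) = mat 1 $ a $ b"
    "(\<Sum>l\<in>UNIV. cnj (v $ l $ a) * v $ l $ b) = mat 1 $ a $ b" for a b
    using v by (auto simp: unitary_matrix_def matrix_matrix_mult_def vec_eq_iff)
  have "?E (?E X) = ?E X" for X
    using C(2) by (simp add: is_cond_exp_def)
  then have "?E \<circ> ?E = ?E" by (simp add: fun_eq_iff)
  moreover have "dual_formula ?E = mat (1 / of_nat CARD('n))"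
  proof -
    have "(\<Sum>l\<in>UNIV. ?E (munit b l) $ a $ l) = mat 1 $ a $ b" for a b
    proof -
      \<comment> \<open>Summing over \<open>l\<close> first gives the squared norm of column
        \<open>j\<close>, which is 1. What remains is the inner product of rows \<open>a\<close> and
        \<open>b\<close>.\<close>
      have "(\<Sum>l\<in>UNIV. ?E (munit b l) $ a $ l)
          = (\<Sum>j\<in>UNIV. v $ a $ j * cnj (v $ b $ j) * (\<Sum>l\<in>UNIV. cnj (v $ l $ j) * v $ l $ j))"
        unfolding conj_expectation_nth conj_munit_diag_nth sum_distrib_left
        by (subst sum.swap) (simp add: mult_ac)
      then show ?thesis by (simp add: vv) (simp add: vv mat_def)
    qed
    then show ?thesis
      by (simp add: vec_eq_iff dual_formula_nth mat_def)
  qed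
  ultimately show ?thesis
    by (simp add: superop_inner_reduced_jones[OF C C] vec_eq_iff mat_def)
qed

text \<open>\<open>n\<^sup>2\<close> times this matrix is \<open>n \<Sum>\<^sub>i\<^sub>j Tr(p\<^sub>i q\<^sub>j) p\<^sub>i q\<^sub>j - 1\<close>.\<close>

definition overlap_matrix :: "complex^'n^'n \<Rightarrow> complex^'n^'n" where
  "overlap_matrix v = (\<chi> a b.
     (\<Sum>j\<in>UNIV. of_real ((cmod (v $ a $ j))\<^sup>2) * v $ a $ j * cnj (v $ b $ j)) / of_nat CARD('n)
     - (if a = b then 1 / of_nat CARD('n) ^ 2 else 0))"

lemma superop_inner_reduced_diagonal:
  fixes v :: "complex^'n^'n"
  assumes v: "unitary_matrix v"
  shows "superop_inner (reduced_jones (conj_algebra (mat 1) diagonal_algebra))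
      (reduced_jones (conj_algebra v diagonal_algebra)) = overlap_matrix v"
proof -
  have 1: "unitary_matrix (mat 1 :: complex^'n^'n)"
    by (simp add: unitary_matrix_def madj_mat)
  have E1: "conj_expectation (mat 1) X = diag_part X" for X :: "complex^'n^'n"
    by (simp add: conj_expectation_def madj_mat)
  \<comment> \<open>\<open>diag_part\<close> keeps only \<open>l = a\<close> in the sum of
    \<open>dual_formula_nth\<close>.\<close>
  have "dual_formula (conj_expectation (mat 1) \<circ> conj_expectation v) $ a $ b
      = (\<Sum>j\<in>UNIV. of_real ((cmod (v $ a $ j))\<^sup>2) * v $ a $ j * cnj (v $ b $ j)) / of_nat CARD('n)"
    for a b
    by (simp add: dual_formula_nth E1 diag_part_nth conj_expectation_nth conj_munit_diag_nth
        complex_norm_square mult_ac del: of_real_power)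
  then show ?thesis
    unfolding superop_inner_reduced_jones[OF conj_diagonal_subalgebra[OF 1]
        conj_expectation_cond_exp[OF 1] conj_diagonal_subalgebra[OF v] conj_expectation_cond_exp[OF v]]
    by (simp add: vec_eq_iff overlap_matrix_def) (simp add: mat_def)
qed

subsection \<open>The operator norm\<close>

lemma matrix_opnorm_triangle: "matrix_opnorm (A + B) \<le> matrix_opnorm A + matrix_opnorm B"
proof -
  have "(*v) (A + B) = (\<lambda>x. A *v x + B *v x)"
    by (simp add: fun_eq_iff matrix_vector_mult_add_rdistrib)
  then show ?thesis
    by (simp add: matrix_opnorm_def onorm_triangle)
qed

text \<open>This crude bound suffices, since it serves only to make the norm continuous in the
  entries.\<close>

lemma matrix_opnorm_le_sum: "matrix_opnorm A \<le> (\<Sum>i\<in>UNIV. \<Sum>j\<in>UNIV. cmod (A $ i $ j))"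
  unfolding matrix_opnorm_def
proof (rule onorm_le)
  fix x
  have "norm (A *v x) \<le> (\<Sum>i\<in>UNIV. cmod ((A *v x) $ i))"
    unfolding norm_vec_def by (rule L2_set_le_sum) simp
  also have "\<dots> \<le> (\<Sum>i\<in>UNIV. \<Sum>j\<in>UNIV. cmod (A $ i $ j) * norm x)"
    unfolding matrix_vector_mult_def
    by (auto simp: norm_mult Finite_Cartesian_Product.norm_nth_le intro!: sum_mono order.trans[OF norm_sum] mult_left_mono)
  finally show "norm (A *v x) \<le> (\<Sum>i\<in>UNIV. \<Sum>j\<in>UNIV. cmod (A $ i $ j)) * norm x"
    by (simp add: sum_distrib_right)
qed

lemma matrix_opnorm_diff_le:
  "\<bar>matrix_opnorm A - matrix_opnorm B\<bar> \<le> (\<Sum>i\<in>UNIV. \<Sum>j\<in>UNIV. cmod (A $ i $ j - B $ i $ j))"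
  using matrix_opnorm_triangle[of "A - B" B] matrix_opnorm_triangle[of "B - A" A]
    matrix_opnorm_le_sum[of "A - B"] matrix_opnorm_le_sum[of "B - A"]
  by (simp add: norm_minus_commute)

lemma continuous_on_matrix_opnorm:
  fixes A :: "real \<Rightarrow> complex^'n^'n"
  assumes "\<And>i j. continuous_on S (\<lambda>t. A t $ i $ j)"
  shows "continuous_on S (\<lambda>t. matrix_opnorm (A t))"
  unfolding continuous_on_def
proof
  fix t assume "t \<in> S"
  then have "((\<lambda>s. \<Sum>i\<in>UNIV. \<Sum>j\<in>UNIV. cmod (A s $ i $ j - A t $ i $ j)) \<longlongrightarrow>
      (\<Sum>i\<in>UNIV. \<Sum>j\<in>UNIV. cmod (A t $ i $ j - A t $ i $ j))) (at t within S)"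
    using assms by (intro tendsto_sum tendsto_norm tendsto_diff tendsto_const) (auto simp: continuous_on_def)
  then have "((\<lambda>s. \<Sum>i\<in>UNIV. \<Sum>j\<in>UNIV. cmod (A s $ i $ j - A t $ i $ j)) \<longlongrightarrow> 0) (at t within S)"
    by simp
  then have "((\<lambda>s. matrix_opnorm (A s) - matrix_opnorm (A t)) \<longlongrightarrow> 0) (at t within S)"
    by (rule Lim_null_comparison[rotated]) (simp add: matrix_opnorm_diff_le)
  then show "((\<lambda>s. matrix_opnorm (A s)) \<longlongrightarrow> matrix_opnorm (A t)) (at t within S)"
    by (simp flip: Lim_null)
qed

lemma matrix_opnorm_mat:
  "matrix_opnorm (mat c :: complex^'n^'n) = cmod c"
proof -
  have mv: "mat c *v x = c *s x" for x :: "complex^'n"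
    by (simp add: vec_eq_iff matrix_vector_mult_def mat_def if_distrib[of "\<lambda>y. y * _"] cong: if_cong)
  have norm: "norm (c *s x) = cmod c * norm x" for x :: "complex^'n"
    by (simp add: norm_vec_def L2_set_def norm_mult power_mult_distrib real_sqrt_mult
        flip: sum_distrib_left)
  show ?thesis
    unfolding matrix_opnorm_def
  proof (rule antisym)
    show "onorm ((*v) (mat c :: complex^'n^'n)) \<le> cmod c"
      by (rule onorm_le) (simp add: mv norm)
    \<comment> \<open>The all-ones vector is the nonzero test vector for the lower bound.\<close>
    have "cmod c * norm (1 :: complex^'n) \<le> onorm ((*v) (mat c :: complex^'n^'n)) * norm (1 :: complex^'n)"
      using onorm[of "(*v) (mat c :: complex^'n^'n)" 1] by (simp add: mv norm)
    moreover have "norm (1 :: complex^'n) > 0"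
      by (simp add: vec_eq_iff)
    ultimately show "cmod c \<le> onorm ((*v) (mat c :: complex^'n^'n))"
      by simp
  qed
qed

subsection \<open>The angle between the diagonal algebra and a conjugate of it\<close>

text \<open>Both reduced projections have norm \<open>sqrt N\<close>, so the quotient defining the
  cosine is \<open>r\<close>. Since \<open>r\<close> lies in [0,1], \<open>arccos r\<close> lies in
  [0, pi/2], where the cosine is injective.\<close>

lemma cos_interior_angle:
  fixes v :: "complex^'n^'n"
  assumes v: "unitary_matrix v" and n: "CARD('n) \<ge> 2"
    and r: "matrix_opnorm (overlap_matrix v) = r * (1 / CARD('n) - 1 / CARD('n) ^ 2)" "0 \<le> r" "r \<le> 1"
  shows "cos (interior_angle (conj_algebra (mat 1) diagonal_algebra)
    (conj_algebra v diagonal_algebra)) = r"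
proof -
  define N where "N = 1 / real CARD('n) - 1 / real CARD('n) ^ 2"
  have N: "N > 0"
    using n by (simp add: N_def field_simps power2_eq_square)
  have 1: "unitary_matrix (mat 1 :: complex^'n^'n)"
    by (simp add: unitary_matrix_def madj_mat)
  have "1 / of_nat CARD('n) - 1 / of_nat CARD('n) ^ 2 = complex_of_real N"
    by (simp add: N_def)
  then have norm: "superop_norm (reduced_jones (conj_algebra w diagonal_algebra)) = sqrt N"
    if "unitary_matrix w" for w :: "complex^'n^'n"
    using N that by (simp add: superop_norm_def superop_inner_reduced_self matrix_opnorm_mat)
  have "interior_angle (conj_algebra (mat 1) diagonal_algebra) (conj_algebra v diagonal_algebra)
      = (THE a. 0 \<le> a \<and> a \<le> pi / 2 \<and> cos a = r)"
    using N r by (simp add: interior_angle_def norm 1 v superop_inner_reduced_diagonal flip: N_def)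
  also have "\<dots> = arccos r"
  proof (rule the_equality)
    show "0 \<le> arccos r \<and> arccos r \<le> pi / 2 \<and> cos (arccos r) = r"
      using arccos_le_pi2[OF r(2,3)] arccos_lbound[of r] r by simp
  qed (auto simp: arccos_cos)
  finally show ?thesis using r by simp
qed

subsection \<open>A unitary path from the identity to a flat circulant matrix\<close>

text \<open>Start of the path: the algebras coincide and the cosine is 1.\<close>

lemma overlap_matrix_one:
  "overlap_matrix (mat 1 :: complex^'n^'n) = mat (1 / of_nat CARD('n) - 1 / of_nat CARD('n) ^ 2)"
proof -
  have "of_real ((cmod ((mat 1 :: complex^'n^'n) $ a $ j))\<^sup>2) * (mat 1 :: complex^'n^'n) $ a $ j
      * cnj ((mat 1 :: complex^'n^'n) $ b $ j) = (if j = a then if a = b then 1 else 0 else 0)" for a b j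
    by (simp add: mat_def)
  then show ?thesis
    unfolding overlap_matrix_def by (simp add: vec_eq_iff) (simp add: mat_def)
qed

text \<open>End of the path: unit rows force \<open>n * s^2 = 1\<close>. The constant squared
  modulus then factors out, and orthonormality of the rows makes the two terms cancel.\<close>

lemma overlap_matrix_flat:
  fixes v :: "complex^'n^'n"
  assumes v: "unitary_matrix v" and s: "\<And>i j. cmod (v $ i $ j) = s"
  shows "overlap_matrix v = 0"
proof -
  have vv: "(\<Sum>j\<in>UNIV. v $ a $ j * cnj (v $ b $ j)) = mat 1 $ a $ b" for a b
    using v by (auto simp: unitary_matrix_def matrix_matrix_mult_def vec_eq_iff)
  have "of_nat CARD('n) * complex_of_real (s\<^sup>2) = 1"
  proof -
    fix a :: 'n
    have "(\<Sum>j\<in>UNIV. v $ a $ j * cnj (v $ a $ j)) = of_nat CARD('n) * complex_of_real (s\<^sup>2)"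
      by (simp add: s flip: complex_norm_square)
    then show ?thesis using vv[of a a] by (simp add: mat_def)
  qed
  then have "complex_of_real (s\<^sup>2) = 1 / of_nat CARD('n)"
    by (simp add: field_simps)
  then have "(\<Sum>j\<in>UNIV. of_real ((cmod (v $ a $ j))\<^sup>2) * v $ a $ j * cnj (v $ b $ j))
      = mat 1 $ a $ b / of_nat CARD('n)" for a b
    by (simp add: s mult.assoc vv flip: of_real_power sum_distrib_left sum_divide_distrib)
  then show ?thesis
    unfolding overlap_matrix_def by (simp add: vec_eq_iff) (simp add: mat_def power2_eq_square)
qed

section \<open>Sums of roots of unity and quadratic chirps\<close>

lemma sum_roots_of_unity:
  fixes k :: int
  assumes n: "n > 0"
  shows "(\<Sum>j<n. cis (2 * pi * real j * of_int k / real n)) = (if int n dvd k then of_nat n else 0)"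
proof -
  \<comment> \<open>The sum is geometric with ratio \<open>z\<close>, an \<open>n\<close>-th root of
    unity that is 1 exactly when \<open>n\<close> divides \<open>k\<close>.\<close>
  define z where "z = cis (2 * pi * (of_int k / real n))"
  have pow: "cis (2 * pi * real j * of_int k / real n) = z ^ j" for j
    by (simp add: z_def Complex.DeMoivre mult_ac)
  have "z ^ n = cis (2 * pi * of_int k)"
    using n by (simp add: z_def Complex.DeMoivre)
  then have zn: "z ^ n = 1"
    by simp
  have "z = 1 \<longleftrightarrow> int n dvd k"
  proof
    assume "z = 1"
    then have "cos (2 * pi * (of_int k / real n)) = 1"
      by (simp add: z_def complex_eq_iff)
    then obtain m :: int where "2 * pi * (of_int k / real n) = of_int m * 2 * pi"
      using cos_one_2pi_int by blast
    then have "of_int k = (of_int (int n * m) :: real)"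
      using n by (simp add: field_simps)
    then show "int n dvd k" by (simp only: of_int_eq_iff) simp
  next
    assume "int n dvd k"
    then obtain m where "k = int n * m" ..
    then show "z = 1"
      using n by (simp add: z_def)
  qed
  moreover have "(\<Sum>j<n. z ^ j) = 0" if "z \<noteq> 1"
    using geometric_sum[OF that, of n] zn by simp
  ultimately show ?thesis
    by (auto simp: pow)
qed

lemma sum_periodic_shift:
  fixes g :: "int \<Rightarrow> 'a :: ab_group_add"
  assumes per: "\<And>m. g (m + int n) = g m"
  shows "(\<Sum>j<n. g (int j + k)) = (\<Sum>j<n. g (int j))"
proof -
  have step: "(\<Sum>j<n. g (int j + (k + 1))) = (\<Sum>j<n. g (int j + k))" for k
  proof -
    \<comment> \<open>Both sides sum \<open>g\<close> from \<open>k\<close> to \<open>k + n\<close>;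
      by periodicity the two end values agree.\<close>
    have "g k + (\<Sum>j<n. g (int (Suc j) + k)) = (\<Sum>j<n. g (int j + k)) + g (int n + k)"
      using sum.lessThan_Suc_shift[of "\<lambda>j. g (int j + k)" n] by simp
    then show ?thesis
      using per[of k] by (simp add: ac_simps)
  qed
  show ?thesis
  \<comment> \<open>The shift may be negative, hence induction on the integers in both
    directions.\<close>
  proof (induction k rule: int_induct[where k = 0])
    case (step2 i)
    then show ?case using step[of "i - 1"] by simp
  qed (simp_all only: step, simp)
qed

text \<open>Completing the square, \<open>j (j + n) + 2 j k = (j + k) (j + k + n) - k (k + n)\<close>, turns this
  exponential sum into a unimodular multiple of its value at \<open>k = 0\<close>. The summand \<open>j n\<close> makes
  the chirp \<open>n\<close>-periodic for odd \<open>n\<close> too.\<close>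

lemma norm_chirp_sum:
  fixes k :: int
  assumes n: "n > 0"
  shows "cmod (\<Sum>j<n. cis (pi * real j * (real j + real n) / real n) * cis (2 * pi * real j * of_int k / real n))
    = cmod (\<Sum>j<n. cis (pi * real j * (real j + real n) / real n))"
proof -
  define g :: "int \<Rightarrow> complex" where "g m = cis (pi * of_int m * (of_int m + real n) / real n)" for m
  have per: "g (m + int n) = g m" for m
  proof -
    have "g (m + int n) = cis (pi * of_int m * (of_int m + real n) / real n + 2 * pi * (of_int m + real n))"
      using n by (simp add: g_def field_simps)
    also have "\<dots> = g m * cis (2 * pi * (of_int m + real n))"
      unfolding g_def cis_mult ..
    also have "cis (2 * pi * (of_int m + real n)) = 1"
      by (rule cis_multiple_2pi) auto
    finally show ?thesis by simp
  qed
  have "cis (pi * real j * (real j + real n) / real n) * cis (2 * pi * real j * of_int k / real n)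
      = cis (- (pi * of_int k * (of_int k + real n) / real n)) * g (int j + k)" for j
  proof -
    have "pi * real j * (real j + real n) / real n + 2 * pi * real j * of_int k / real n
        = - (pi * of_int k * (of_int k + real n) / real n)
          + pi * of_int (int j + k) * (of_int (int j + k) + real n) / real n"
      using n by (simp add: field_simps)
    then show ?thesis
      by (simp only: g_def cis_mult)
  qed
  then show ?thesis
    using sum_periodic_shift[of g n k, OF per] by (simp add: norm_mult g_def flip: sum_distrib_left)
qed

section \<open>The path of unitary circulants\<close>

lemma ex_unitary_path:
  obtains v :: "real \<Rightarrow> complex^'n^'n" and s :: real
  where "\<And>t. unitary_matrix (v t)" "\<And>i j. continuous_on UNIV (\<lambda>t. v t $ i $ j)"
    "v 0 = mat 1" "\<And>i j. cmod (v 1 $ i $ j) = s"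
proof -
  define n where "n = CARD('n)"
  have n: "n > 0" by (simp add: n_def)
  \<comment> \<open>\<open>h\<close> labels the index type by 0, ..., n-1, so that indices can enter
    exponents.\<close>
  obtain h where "bij_betw h (UNIV :: 'n set) {0..<n}"
    unfolding n_def using ex_bij_betw_finite_nat[OF finite] by blast
  then have h: "bij_betw h (UNIV :: 'n set) {..<n}"
    by (simp add: atLeast0LessThan)
  have reindex: "(\<Sum>c\<in>UNIV. f (h c)) = (\<Sum>j<n. f j)" for f :: "nat \<Rightarrow> complex"
    by (rule sum.reindex_bij_betw[OF h])
  \<comment> \<open>Labels lie below \<open>n\<close>, so two of them are congruent modulo
    \<open>n\<close> only if equal.\<close>
  have hdvd: "int n dvd int (h a) - int (h b) \<longleftrightarrow> a = b" for a b
  proof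
    assume dvd: "int n dvd int (h a) - int (h b)"
    have "h a < n" "h b < n" using h by (auto simp: bij_betw_def)
    then have "h a = h b"
      using dvd zdvd_not_zless[of "\<bar>int (h a) - int (h b)\<bar>" "int n"] by fastforce
    then show "a = b" using h by (auto simp: bij_betw_def inj_on_def)
  qed simp
  define F :: "complex^'n^'n" where
    "F = (\<chi> a b. cis (2 * pi * real (h a) * real (h b) / n) / of_real (sqrt n))"
  \<comment> \<open>The weights \<open>x\<close> are arbitrary: constant 1 gives the unitarity of
    \<open>F\<close>, eigenvalues of modulus 1 give the entries of \<open>v t\<close>.\<close>
  have conv: "(\<Sum>c\<in>UNIV. x c * F $ a $ c * cnj (F $ b $ c)) =
      (\<Sum>c\<in>UNIV. x c * cis (2 * pi * real (h c) * of_int (int (h a) - int (h b)) / n)) / of_nat n"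
    for x a b
  proof -
    have "F $ a $ c * cnj (F $ b $ c)
        = cis (2 * pi * real (h c) * of_int (int (h a) - int (h b)) / n) / of_nat n" for c
    proof -
      have "complex_of_real (sqrt n) * complex_of_real (sqrt n) = of_nat n"
        by (simp flip: of_real_mult)
      then show ?thesis
        by (simp add: F_def cis_cnj cis_mult times_divide_times_eq algebra_simps diff_divide_distrib)
    qed
    then show ?thesis
      by (simp only: mult.assoc sum_divide_distrib times_divide_eq_right)
  qed
  have FF: "F ** madj F = mat 1"
  proof -
    have "(F ** madj F) $ a $ b = mat 1 $ a $ b" for a b
      using conv[of "\<lambda>_. 1" a b] n
        reindex[of "\<lambda>j. cis (2 * pi * real j * of_int (int (h a) - int (h b)) / n)"]
        sum_roots_of_unity[OF n, of "int (h a) - int (h b)"]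
      by (simp add: matrix_matrix_mult_def hdvd mat_def del: of_int_diff)
    then show ?thesis by (simp add: vec_eq_iff)
  qed
  then have FF': "madj F ** F = mat 1"
    using matrix_left_right_inverse by blast
  define \<theta> where "\<theta> j = pi * real j * (real j + real n) / n" for j
  define d :: "real \<Rightarrow> complex^'n^'n" where
    "d t = (\<chi> a b. if a = b then cis (t * \<theta> (h a)) else 0)" for t
  have d: "d t \<in> diagonal_algebra" for t
    by (simp add: d_def diagonal_algebra_def)
  define v where "v t = F ** d t ** madj F" for t
  have v_nth: "v t $ a $ b = (\<Sum>c\<in>UNIV. cis (t * \<theta> (h c)) * F $ a $ c * cnj (F $ b $ c))" for t a b
    unfolding v_def matrix_matrix_mult_def[of "F ** _"]
    by (simp add: diag_mult_nth[OF d]) (simp add: d_def mult_ac)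
  have cancel: "A ** (B ** X) = X" if "A ** B = mat 1" for A B X :: "complex^'n^'n"
    using that by (simp add: matrix_mul_assoc)
  show thesis
  proof
    show "unitary_matrix (v t)" for t
    proof -
      have "d t ** madj (d t) = mat 1"
        by (simp add: vec_eq_iff diag_mult_nth[OF d]) (simp add: d_def mat_def cis_cnj cis_mult)
      moreover from this have "madj (d t) ** d t = mat 1"
        using matrix_left_right_inverse by blast
      moreover have "madj (v t) = F ** madj (d t) ** madj F"
        by (simp add: v_def madj_mult matrix_mul_assoc)
      ultimately show ?thesis
        using cancel[OF FF'] cancel[of "d t" "madj (d t)"] cancel[of "madj (d t)" "d t"]
        by (simp add: unitary_matrix_def v_def FF flip: matrix_mul_assoc)
    qed
    show "continuous_on UNIV (\<lambda>t. v t $ i $ j)" for i j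
      unfolding v_nth by (intro continuous_intros)
    have "d 0 = mat 1"
      by (simp add: d_def mat_def vec_eq_iff)
    then show "v 0 = mat 1"
      by (simp add: v_def FF)
    \<comment> \<open>The entry is a chirp sum twisted by \<open>h i - h j\<close> and divided by
      \<open>n\<close>; \<open>norm_chirp_sum\<close> removes the twist.\<close>
    show "cmod (v 1 $ i $ j) = cmod (\<Sum>j<n. cis (\<theta> j)) / n" for i j
      using norm_chirp_sum[OF n, of "int (h i) - int (h j)"]
        reindex[of "\<lambda>m. cis (\<theta> m) * cis (2 * pi * real m * of_int (int (h i) - int (h j)) / n)"]
      by (simp add: v_nth conv norm_divide \<theta>_def del: of_int_diff)
  qed
qed

theorem theorem5p23:
  fixes r :: real
  assumes "CARD('n::finite) \<ge> 2" and "0 \<le> r" and "r \<le> 1"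
  shows "\<exists>u v :: complex^'n^'n. unitary_matrix u \<and> unitary_matrix v \<and>
           cos (interior_angle (conj_algebra u diagonal_algebra)
                               (conj_algebra v diagonal_algebra)) = r"
proof -
  define N where "N = 1 / real CARD('n) - 1 / real CARD('n) ^ 2"
  have N: "N > 0"
    using assms(1) by (simp add: N_def field_simps power2_eq_square)
  obtain v :: "real \<Rightarrow> complex^'n^'n" and s where v: "\<And>t. unitary_matrix (v t)"
    and cont: "\<And>i j. continuous_on UNIV (\<lambda>t. v t $ i $ j)"
    and v0: "v 0 = mat 1" and v1: "\<And>i j. cmod (v 1 $ i $ j) = s"
    using ex_unitary_path by blast
  let ?f = "\<lambda>t. matrix_opnorm (overlap_matrix (v t))"
  \<comment> \<open>Each overlap entry is built from entries of \<open>v t\<close> by sums,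
    products, moduli and conjugation.\<close>
  have "continuous_on {0..1} ?f"
    unfolding overlap_matrix_def
    by (intro continuous_on_matrix_opnorm, unfold vec_lambda_beta,
        intro continuous_intros continuous_on_subset[OF cont]) auto
  moreover have "overlap_matrix (mat 1 :: complex^'n^'n) = mat (complex_of_real N)"
    by (simp add: overlap_matrix_one N_def)
  then have "?f 0 = N"
    using N by (simp add: v0 matrix_opnorm_mat)
  moreover have "?f 1 = 0"
    using matrix_opnorm_mat[of 0, where 'n = 'n] by (simp add: overlap_matrix_flat[OF v v1])
  moreover have "0 \<le> r * N" "r * N \<le> N"
    using N assms by (auto intro: mult_left_le_one_le)
  \<comment> \<open>The norm runs from \<open>N\<close> at 0 down to 0 at 1, so the decreasing form
    of the intermediate value theorem applies.\<close>
  ultimately obtain t where "?f t = r * N"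
    using IVT2'[of ?f 1 "r * N" 0] by auto
  then have "cos (interior_angle (conj_algebra (mat 1) diagonal_algebra)
      (conj_algebra (v t) diagonal_algebra)) = r"
    using assms v by (intro cos_interior_angle) (auto simp: N_def)
  moreover have "unitary_matrix (mat 1 :: complex^'n^'n)"
    by (simp add: unitary_matrix_def madj_mat)
  ultimately show ?thesis using v by blast
qed

end
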